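(* Let $F=(f_1,\dots,f_k):\mathbb{R}^n\to\mathbb{R}^k$ be continuous with continuously differentiable components, let $Q\subset\mathbb{R}^n$ be compact, let $\epsilon\in\mathbb{R}^k_+$ and $\Delta,\Delta^*\in\mathbb{R}_+$ with $\Delta^*<\Delta$. Consider the multi-objective optimization problem $\min_{x\in Q}F(x)$. Let $(P_l)_{l\in\mathbb{N}}$ be the random candidate sets produced by the generic stochastic search algorithm, and assume $$\forall x\in Q\ \text{and}\ \forall\delta>0:\quad \mathbb{P}\left(\exists l\in\mathbb{N}:\ P_l\cap B_\delta(x)\cap Q\neq\emptyset\right)=1 .$$ Assume further: (A1) there is no weak Pareto point in $Q\setminus P_Q$; (A2) there is no $-\epsilon$ weak Pareto point in $Q\setminus\overline{P_{Q,\epsilon}}$; (A3) with $\mathcal{B}:=\{x\in Q\mid \exists y\in P_Q:\ F(y)+\epsilon=F(x)\}$, one has $\mathcal{B}\subset\overset{\circ}{Q}$ and $q(x)\neq0$ for all $x\in\mathcal{B}$. Then the generic stochastic search algorithm, with $\mathit{ArchiveUpdateP}_{Q,\epsilon}(P,A,\Delta)$ used to update the archive, produces a sequence of archives $A_l$, $l\in\mathbb{N}$, for which the following holds: (a) For all $l\in\mathbb{N}$ and all $a_1,a_2\in A_l$ with $a_1\ne a_2$: $\|F(a_1)-F(a_2)\|_\infty\ge\Delta^*$. (b) With probability one there exists $l_0\in\mathbb{N}$ such that for all $l\ge l_0$: (b1) $\mathrm{dist}(F(P_{Q,\epsilon}),F(A_l))<\Delta$, (b2) $\mathrm{dist}(F(A_l),F(P_{Q,\epsilon}))\le\mathrm{dist}(F(P_{Q,\epsilon+2\Delta}),F(P_{Q,\epsilon}))$,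 (b3) $d_H(F(P_{Q,\epsilon}),F(A_l))\le D$, where $D=\max\big(\Delta,\ \mathrm{dist}(F(P_{Q,\epsilon+2\Delta}),F(P_{Q,\epsilon}))\big)$.
   Context: $\mathbb{R}_+$ denotes the positive reals and $\mathbb{R}^k_+$ the vectors with all components positive. For $v,w\in\mathbb{R}^k$, $v<_pw$ (resp. $v\leq_pw$) means $v_i<w_i$ (resp. $v_i\le w_i$) for all $i$. $x\prec y$ ($x$ dominates $y$) means $F(x)\leq_pF(y)$ and $F(x)\ne F(y)$. For $\epsilon\in\mathbb{R}^k_+$, $x\prec_{-\epsilon}y$ ($x$ $-\epsilon$-dominates $y$) means $F(x)+\epsilon\leq_pF(y)$ and $F(x)+\epsilon\neq F(y)$. The Pareto set $P_Q$ is the set of $x\in Q$ such that no $y\in Q$ satisfies $y\prec x$. $P_{Q,\epsilon}:=\{x\in Q\mid\not\exists y\in Q:\ y\prec_{-\epsilon}x\}$. $1\Delta:=(\Delta,\dots,\Delta)\in\mathbb{R}^k_+$, and $P_{Q,\epsilon+2\Delta}$ means $P_{Q,\epsilon'}$ with $\epsilon'=\epsilon+2\cdot1\Delta$. A point $x\in Q$ is a weak Pareto point if there is no $y\in Q$ with $F(y)<_pF(x)$; it is a $-\epsilon$ weak Pareto point if there is no $y\in Q$ with $F(y)+\epsilon<_pF(x)$. $q(x):=\sum_{i=1}^k\hat\alpha_i\nabla f_i(x)$, where $\hat\alpha$ is a solution of $\min_{\alpha\in\mathbb{R}^k}\{\|\sum_{i=1}^k\alpha_i\nabla f_i(x)\|_2^2:\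 \alpha_i\ge0,\ i=1,\dots,k,\ \sum_{i=1}^k\alpha_i=1\}$. $\overline{A}$ and $\overset{\circ}{A}$ denote closure and interior; $B_\delta(x)$ is the open ball of radius $\delta$ about $x$. For a point $u$ and sets $A,B$: $\mathrm{dist}(u,A):=\inf_{v\in A}\|u-v\|$, $\mathrm{dist}(B,A):=\sup_{u\in B}\mathrm{dist}(u,A)$, $d_H(A,B):=\max\{\mathrm{dist}(A,B),\mathrm{dist}(B,A)\}$; in image space $\mathbb{R}^k$ the norm used is $\|\cdot\|_\infty$, and $d_\infty(u,v)=\|u-v\|_\infty$. Generic stochastic search algorithm: $P_0\subset Q$ is drawn at random and $A_0=\mathit{ArchiveUpdate}(P_0,\emptyset)$; for $j=0,1,2,\dots$, $P_{j+1}=\mathit{Generate}(P_j)\subset Q$ (a random generation process) and $A_{j+1}=\mathit{ArchiveUpdate}(P_{j+1},A_j)$. All $P_j$ are finite sets. Procedure $\mathit{ArchiveUpdateP}_{Q,\epsilon}(P,A_{\mathrm{in}},\Delta)$, with parameters $\epsilon$, $\Delta$ and $\Delta^*\in(0,\Delta)$: set $A:=A_{\mathrm{in}}$. Process the elements $p\in P$ one after another (in any order). For each $p$: if there is no $a_1\in A$ with $a_1\prec_{-\epsilon}p$ and there is no $a_2\in A$ with $d_\infty(F(a_2),F(p))\le\Delta^*$, then set $A:=A\cup\{p\}$ and afterwards remove from $A$ every $a\in A$ with $p\prec_{-(\epsilon+1\Delta)}a$; otherwise leave $A$ unchanged. Return $A$. *)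

theory Defs
  imports "HOL-Probability.Probability"
begin

text \<open>
  The relation \<open>\<le>\<close> of the library on \<open>real ^ 'k\<close> is the componentwise order \<open>\<le>\<^sub>p\<close>. The library's \<open><\<close>
  on that type is only "\<open>\<le>\<close> and not \<open>\<ge>\<close>", so \<open><\<^sub>p\<close> needs its own definition.
\<close>

definition less_p :: "real ^ 'k \<Rightarrow> real ^ 'k \<Rightarrow> bool" (infix "<\<^sub>p" 50) where
  "v <\<^sub>p w \<longleftrightarrow> (\<forall>i. v $ i < w $ i)"

definition dominates :: "('a \<Rightarrow> real ^ 'k) \<Rightarrow> 'a \<Rightarrow> 'a \<Rightarrow> bool" where
  "dominates F x y \<longleftrightarrow> F x \<le> F y \<and> F x \<noteq> F y"

text \<open>\<open>neg_dominates F \<epsilon> x y\<close>: \<open>x\<close> \<open>-\<epsilon>\<close>-dominates \<open>y\<close>.\<close>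

definition neg_dominates :: "('a \<Rightarrow> real ^ 'k) \<Rightarrow> real ^ 'k \<Rightarrow> 'a \<Rightarrow> 'a \<Rightarrow> bool" where
  "neg_dominates F \<epsilon> x y \<longleftrightarrow> F x + \<epsilon> \<le> F y \<and> F x + \<epsilon> \<noteq> F y"

definition pareto_set :: "('a \<Rightarrow> real ^ 'k) \<Rightarrow> 'a set \<Rightarrow> 'a set" where
  "pareto_set F Q = {x \<in> Q. \<not> (\<exists>y\<in>Q. dominates F y x)}"

definition eps_pareto_set :: "('a \<Rightarrow> real ^ 'k) \<Rightarrow> 'a set \<Rightarrow> real ^ 'k \<Rightarrow> 'a set" where
  "eps_pareto_set F Q \<epsilon> = {x \<in> Q. \<not> (\<exists>y\<in>Q. neg_dominates F \<epsilon> y x)}"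

definition weak_pareto :: "('a \<Rightarrow> real ^ 'k) \<Rightarrow> 'a set \<Rightarrow> 'a \<Rightarrow> bool" where
  "weak_pareto F Q x \<longleftrightarrow> x \<in> Q \<and> \<not> (\<exists>y\<in>Q. F y <\<^sub>p F x)"

definition neg_eps_weak_pareto :: "('a \<Rightarrow> real ^ 'k) \<Rightarrow> 'a set \<Rightarrow> real ^ 'k \<Rightarrow> 'a \<Rightarrow> bool" where
  "neg_eps_weak_pareto F Q \<epsilon> x \<longleftrightarrow> x \<in> Q \<and> \<not> (\<exists>y\<in>Q. F y + \<epsilon> <\<^sub>p F x)"

text \<open>
  \<open>g i\<close> is the gradient of the \<open>i\<close>-th objective at the point under consideration. \<open>arg_min\<close> picks
  some minimiser; different minimising weights give the same vector, namely the element of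
  least norm in the convex hull of the gradients.
\<close>

definition min_norm_comb :: "('k::finite \<Rightarrow> real ^ 'n) \<Rightarrow> real ^ 'n" where
  "min_norm_comb g =
    (let \<alpha> = arg_min (\<lambda>\<alpha>. (norm (\<Sum>i\<in>UNIV. \<alpha> $ i *\<^sub>R g i))\<^sup>2)
                     (\<lambda>\<alpha> :: real ^ 'k. (\<forall>i. 0 \<le> \<alpha> $ i) \<and> (\<Sum>i\<in>UNIV. \<alpha> $ i) = 1)
     in \<Sum>i\<in>UNIV. \<alpha> $ i *\<^sub>R g i)"

text \<open>
  All distances use the maximum norm and take values in \<open>[0, \<infinity>]\<close>: the infimum over the empty set
  is \<open>\<infinity>\<close> and the supremum over the empty set is \<open>0\<close>.
\<close>

definition dist_point :: "real ^ 'k \<Rightarrow> (real ^ 'k) set \<Rightarrow> ennreal" where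
  "dist_point u A = (INF v\<in>A. ennreal (infnorm (u - v)))"

definition dist_set :: "(real ^ 'k) set \<Rightarrow> (real ^ 'k) set \<Rightarrow> ennreal" where
  "dist_set B A = (SUP u\<in>B. dist_point u A)"

definition dist_H :: "(real ^ 'k) set \<Rightarrow> (real ^ 'k) set \<Rightarrow> ennreal" where
  "dist_H A B = max (dist_set A B) (dist_set B A)"

text \<open>Here \<open>\<Delta>s\<close> stands for the parameter \<open>\<Delta>*\<close>, with \<open>0 < \<Delta>* < \<Delta>\<close>.\<close>

definition archive_insert ::
  "('a \<Rightarrow> real ^ 'k) \<Rightarrow> real ^ 'k \<Rightarrow> real \<Rightarrow> real \<Rightarrow> 'a \<Rightarrow> 'a set \<Rightarrow> 'a set" where
  "archive_insert F \<epsilon> \<Delta> \<Delta>s p A =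
    (if \<not> (\<exists>a\<^sub>1\<in>A. neg_dominates F \<epsilon> a\<^sub>1 p) \<and> \<not> (\<exists>a\<^sub>2\<in>A. infnorm (F a\<^sub>2 - F p) \<le> \<Delta>s)
     then {a \<in> A \<union> {p}. \<not> neg_dominates F (\<epsilon> + vec \<Delta>) p a}
     else A)"

text \<open>
  The set of all possible results of the update, one for each order in which the elements of
  the finite set \<open>P\<close> may be processed.
\<close>

definition archive_update ::
  "('a \<Rightarrow> real ^ 'k) \<Rightarrow> real ^ 'k \<Rightarrow> real \<Rightarrow> real \<Rightarrow> 'a set \<Rightarrow> 'a set \<Rightarrow> 'a set set" where
  "archive_update F \<epsilon> \<Delta> \<Delta>s P A =
    {fold (archive_insert F \<epsilon> \<Delta> \<Delta>s) ps A | ps. set ps = P \<and> distinct ps}"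

text \<open>
  The random candidate sets \<open>P j\<close> and archives \<open>A j\<close> are functions of the outcome \<open>\<omega>\<close>. The random
  operator \<open>Gen\<close> may depend on the iteration \<open>j\<close> and on \<open>\<omega>\<close> without restriction, and so may the
  choice of a result of the update. No measurability is built in.
\<close>

definition generic_search ::
  "'w measure \<Rightarrow> 'a set \<Rightarrow> (nat \<Rightarrow> 'w \<Rightarrow> 'a set \<Rightarrow> 'a set) \<Rightarrow> ('a set \<Rightarrow> 'a set \<Rightarrow> 'a set set)
    \<Rightarrow> (nat \<Rightarrow> 'w \<Rightarrow> 'a set) \<Rightarrow> (nat \<Rightarrow> 'w \<Rightarrow> 'a set) \<Rightarrow> bool" where
  "generic_search M Q Gen Upd P A \<longleftrightarrow>
    (\<forall>\<omega>\<in>space M.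
      (\<forall>j. finite (P j \<omega>) \<and> P j \<omega> \<subseteq> Q) \<and>
      A 0 \<omega> \<in> Upd (P 0 \<omega>) {} \<and>
      (\<forall>j. P (Suc j) \<omega> = Gen j \<omega> (P j \<omega>) \<and>
           A (Suc j) \<omega> \<in> Upd (P (Suc j) \<omega>) (A j \<omega>)))"

end

theory Submission
  imports Defs
begin

text \<open>
  Call \<open>p \<in> Q\<close> robust if \<open>F y + \<epsilon> \<le> F p\<close> for no \<open>y \<in> Q\<close>. A robust candidate is never rejected on
  account of domination, so once it is processed the archive has a point within \<open>\<Delta>*\<close> of it in image
  space; such a point is never removed, since \<open>\<Delta>* < \<Delta>\<close>. Robustness is an open condition. A point of
  \<open>P\<^bsub>Q,\<epsilon>\<^esub>\<close> that is not robust lies in \<open>\<B>\<close>, where \<open>-q\<close> is a common descent direction, and moving along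
  it makes the point robust. Hence finitely many sampled points certify (b1).
  For (b2), no archive member ever \<open>-(\<epsilon> + \<Delta>)\<close>-dominates another one. As Pareto points are in \<open>P\<^bsub>Q,\<epsilon>\<^esub>\<close>,
  (b1) then forces the archive into \<open>P\<^bsub>Q,\<epsilon>+2\<Delta>\<^esub>\<close>.
\<close>

section \<open>Descent along the negative of the least-norm convex combination of the
  gradients\<close>

text \<open>This is the variational inequality for the projection of the origin onto the convex hull
  of the gradients. It makes the negative of a nonzero \<open>min_norm_comb g\<close> a descent
  direction for all objectives at once.\<close>

lemma min_norm_comb_inner:
  fixes g :: "'k::finite \<Rightarrow> real ^ 'n"
  shows "(norm (min_norm_comb g))\<^sup>2 \<le> g i \<bullet> min_norm_comb g"
proof -
  define S where "S = {\<alpha> :: real ^ 'k. (\<forall>i. 0 \<le> \<alpha> $ i) \<and> (\<Sum>i\<in>UNIV. \<alpha> $ i) = 1}"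
  define h where "h = (\<lambda>\<alpha> :: real ^ 'k. \<Sum>i\<in>UNIV. \<alpha> $ i *\<^sub>R g i)"
  have lin: "linear h"
    unfolding h_def
    by (intro linearI) (simp_all add: scaleR_left_distrib sum.distrib scaleR_sum_right)
  have axis_S: "axis j 1 \<in> S" for j
    by (auto simp: S_def axis_def)
  have "S \<subseteq> cbox 0 1"
  proof
    fix \<alpha> assume "\<alpha> \<in> S"
    then have nn: "\<And>i. 0 \<le> \<alpha> $ i" and s1: "(\<Sum>i\<in>UNIV. \<alpha> $ i) = 1" by (auto simp: S_def)
    have "\<alpha> $ i \<le> 1" for i
      using member_le_sum[of i UNIV "\<lambda>i. \<alpha> $ i"] nn s1 by simp
    then show "\<alpha> \<in> cbox 0 1" using nn by (simp add: mem_box_cart)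
  qed
  then have "bounded S" using bounded_cbox bounded_subset by blast
  moreover have "closed S"
    unfolding S_def
    by (intro closed_Collect_conj closed_Collect_all closed_Collect_le closed_Collect_eq
        continuous_intros)
  ultimately have "compact S" by (simp add: compact_eq_bounded_closed)
  have conv: "convex S"
  proof (rule convexI)
    fix \<alpha> \<beta> :: "real ^ 'k" and u v :: real
    assume *: "\<alpha> \<in> S" "\<beta> \<in> S" "0 \<le> u" "0 \<le> v" "u + v = 1"
    have "(\<Sum>i\<in>UNIV. u * \<alpha> $ i + v * \<beta> $ i) = u * (\<Sum>i\<in>UNIV. \<alpha> $ i) + v * (\<Sum>i\<in>UNIV. \<beta> $ i)"
      by (simp add: sum.distrib sum_distrib_left)
    with * show "u *\<^sub>R \<alpha> + v *\<^sub>R \<beta> \<in> S" by (simp add: S_def)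
  qed
  have conth: "continuous_on S h"
    using lin by (simp add: linear_continuous_on linear_conv_bounded_linear)
  \<comment> \<open>\<open>arg_min\<close> is a choice operator, so its value is a minimiser only
    once a minimiser is known to exist; compactness of the simplex \<open>S\<close> provides
    one.\<close>
  have "\<exists>\<alpha>\<in>S. \<forall>\<beta>\<in>S. (norm (h \<alpha>))\<^sup>2 \<le> (norm (h \<beta>))\<^sup>2"
    using \<open>compact S\<close> axis_S conth
    by (intro continuous_attains_inf continuous_intros) auto
  then have "\<exists>\<alpha>. is_arg_min (\<lambda>\<alpha>. (norm (h \<alpha>))\<^sup>2) (\<lambda>\<alpha>. \<alpha> \<in> S) \<alpha>"
    by (auto simp: is_arg_min_linorder)
  then have "is_arg_min (\<lambda>\<alpha>. (norm (h \<alpha>))\<^sup>2) (\<lambda>\<alpha>. \<alpha> \<in> S) (arg_min (\<lambda>\<alpha>. (norm (h \<alpha>))\<^sup>2) (\<lambda>\<alpha>. \<alpha> \<in> S))"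
    unfolding arg_min_def by (rule someI_ex)
  moreover define \<alpha> where "\<alpha> = arg_min (\<lambda>\<alpha>. (norm (h \<alpha>))\<^sup>2) (\<lambda>\<alpha>. \<alpha> \<in> S)"
  ultimately have "\<alpha> \<in> S" and min: "\<And>\<beta>. \<beta> \<in> S \<Longrightarrow> norm (h \<alpha>) \<le> norm (h \<beta>)"
    by (auto simp: is_arg_min_linorder)
  have q: "min_norm_comb g = h \<alpha>"
    by (simp add: min_norm_comb_def \<alpha>_def h_def S_def Let_def)
  \<comment> \<open>The vertices of the simplex put each gradient into the convex compact image of
    \<open>S\<close> under \<open>h\<close>, in which \<open>h \<alpha>\<close> is the point closest
    to 0.\<close>
  have gi: "g i = h (axis i 1)"
    by (simp add: h_def axis_def if_distrib[of "\<lambda>c. c *\<^sub>R _"] cong: if_cong)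
  have "(0 - h \<alpha>) \<bullet> (g i - h \<alpha>) \<le> 0"
    by (rule any_closest_point_dot[of "h ` S"])
      (use conv lin \<open>compact S\<close> conth \<open>\<alpha> \<in> S\<close> axis_S min gi in
        \<open>auto intro: convex_linear_image compact_imp_closed compact_continuous_image\<close>)
  then show ?thesis
    by (simp add: q inner_diff_right power2_norm_eq_inner inner_commute)
qed

text \<open>Along \<open>-q\<close> the i-th directional derivative is
  \<open>- (g i \<bullet> q)\<close>, at most the negative of the squared norm of \<open>q\<close>.
  As there are finitely many objectives, one small step decreases them all and stays in
  \<open>U\<close>.\<close>

lemma common_descent:
  fixes F :: "real ^ 'n \<Rightarrow> real ^ 'k"
  assumes grad: "\<And>i. GDERIV (\<lambda>z. F z $ i) x :> g i"
    and q: "min_norm_comb g \<noteq> 0"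
    and U: "open U" "x \<in> U"
  shows "\<exists>p\<in>U. F p <\<^sub>p F x"
proof -
  define q where "q = min_norm_comb g"
  have "\<forall>\<^sub>F t in at_right 0. F (x - t *\<^sub>R q) $ i < F x $ i" for i
  proof -
    have "((\<lambda>t::real. x - t *\<^sub>R q) has_derivative (\<lambda>t. - t *\<^sub>R q)) (at 0)"
      by (auto intro!: derivative_eq_intros)
    moreover have "((\<lambda>z. F z $ i) has_derivative (\<lambda>h. h \<bullet> g i)) (at (x - 0 *\<^sub>R q))"
      using grad[of i] by (simp add: gderiv_def)
    ultimately have "((\<lambda>t. F (x - t *\<^sub>R q) $ i) has_derivative (\<lambda>t. (- t *\<^sub>R q) \<bullet> g i)) (at 0)"
      by (rule has_derivative_compose)
    then have "((\<lambda>t. F (x - t *\<^sub>R q) $ i) has_real_derivative - (g i \<bullet> q)) (at 0)"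
      by (rule has_derivative_imp_has_field_derivative) (simp add: inner_commute)
    moreover have "- (g i \<bullet> q) < 0"
      using min_norm_comb_inner[of g i] q unfolding q_def
      by (metis neg_less_0_iff_less order_less_le_trans zero_less_norm_iff zero_less_power)
    ultimately obtain d where "d > 0" "\<forall>h>0. h < d \<longrightarrow> F (x - h *\<^sub>R q) $ i < F x $ i"
      by (force dest: DERIV_neg_dec_right)
    then show ?thesis
      by (auto simp: eventually_at_right_field)
  qed
  then have "\<forall>\<^sub>F t in at_right 0. F (x - t *\<^sub>R q) <\<^sub>p F x"
    unfolding less_p_def by (rule eventually_all_finite)
  moreover have "((\<lambda>t::real. x - t *\<^sub>R q) \<longlongrightarrow> x - 0 *\<^sub>R q) (at_right 0)"
    by (intro tendsto_intros)
  then have "\<forall>\<^sub>F t::real in at_right 0. x - t *\<^sub>R q \<in> U"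
    using U by (auto dest: topological_tendstoD)
  ultimately have "\<forall>\<^sub>F t::real in at_right 0. x - t *\<^sub>R q \<in> U \<and> F (x - t *\<^sub>R q) <\<^sub>p F x"
    by eventually_elim simp
  then show ?thesis
    using eventually_happens[of _ "at_right (0::real)"] by force
qed

section \<open>Robust points and the approximation of \<open>eps_pareto_set\<close> by them\<close>

text \<open>Distinctness holds because the index type is nonempty.\<close>

lemma less_p_imp: "v <\<^sub>p w \<Longrightarrow> v \<le> w \<and> v \<noteq> w"
  by (auto simp: less_p_def less_eq_vec_def less_imp_le)

text \<open>For \<open>p\<close> in \<open>Q\<close> this is stronger than membership in
  \<open>eps_pareto_set\<close>: the boundary case \<open>F y + \<epsilon> = F p\<close> is excluded
  as well.\<close>

definition robust :: "('a \<Rightarrow> real ^ 'k) \<Rightarrow> 'a set \<Rightarrow> real ^ 'k \<Rightarrow> 'a \<Rightarrow> bool" where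
  "robust F Q \<epsilon> p \<longleftrightarrow> \<not> (\<exists>y\<in>Q. F y + \<epsilon> \<le> F p)"

text \<open>The non-robust points of \<open>Q\<close> are the second projection of the compact set
  \<open>T\<close> of pairs violating the condition, hence form a closed set.\<close>

lemma robust_open:
  fixes F :: "'a::metric_space \<Rightarrow> real ^ 'k"
  assumes "continuous_on Q F" "compact Q" "p \<in> Q" "robust F Q \<epsilon> p"
  obtains \<delta> where "\<delta> > 0" "\<And>z. z \<in> Q \<Longrightarrow> dist p z < \<delta> \<Longrightarrow> robust F Q \<epsilon> z"
proof -
  define T where "T = {yz \<in> Q \<times> Q. \<forall>i. F (fst yz) $ i + \<epsilon> $ i \<le> F (snd yz) $ i}"
  have c: "compact (Q \<times> Q)" using assms(2) by (simp add: compact_Times)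
  have cf: "continuous_on (Q \<times> Q) (\<lambda>yz. F (fst yz))" "continuous_on (Q \<times> Q) (\<lambda>yz. F (snd yz))"
    by (auto intro!: continuous_on_compose2[OF assms(1)] continuous_intros)
  have "closed {yz \<in> Q \<times> Q. F (fst yz) $ i + \<epsilon> $ i \<le> F (snd yz) $ i}" for i
    using c cf by (intro continuous_on_closed_Collect_le continuous_intros compact_imp_closed)
  then have "closed (\<Inter>i. {yz \<in> Q \<times> Q. F (fst yz) $ i + \<epsilon> $ i \<le> F (snd yz) $ i})"
    by auto
  moreover have "T = Q \<times> Q \<inter> (\<Inter>i. {yz \<in> Q \<times> Q. F (fst yz) $ i + \<epsilon> $ i \<le> F (snd yz) $ i})"
    by (auto simp: T_def)
  ultimately have "compact T" using c by (simp add: compact_Int_closed)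
  then have "compact (snd ` T)" by (intro compact_continuous_image continuous_intros)
  then have "open (- snd ` T)" by (simp add: compact_imp_closed open_Compl)
  moreover have "p \<in> - snd ` T"
    using assms(4) by (auto simp: T_def robust_def less_eq_vec_def)
  ultimately obtain \<delta> where "\<delta> > 0" "ball p \<delta> \<subseteq> - snd ` T" by (meson openE)
  moreover have "robust F Q \<epsilon> z" if "z \<in> Q" "dist p z < \<delta>" for z
  proof (rule ccontr)
    assume "\<not> robust F Q \<epsilon> z"
    then obtain y where "y \<in> Q" "F y + \<epsilon> \<le> F z" by (auto simp: robust_def)
    then have "(y, z) \<in> T" using that by (auto simp: T_def less_eq_vec_def)
    then have "z \<in> snd ` T" by force
    with \<open>ball p \<delta> \<subseteq> _\<close> that show False by auto
  qed
  ultimately show thesis using that by blast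
qed

text \<open>From \<open>F y + \<epsilon> \<le> F p\<close> and \<open>F p <\<^sub>p F x\<close> the
  value \<open>F y + \<epsilon>\<close> would lie strictly below \<open>F x\<close> in every
  component, so \<open>y\<close> would -\<epsilon>-dominate \<open>x\<close>.\<close>

lemma robust_below:
  assumes "x \<in> eps_pareto_set F Q \<epsilon>" "F p <\<^sub>p F x"
  shows "robust F Q \<epsilon> p"
proof -
  have "F y + \<epsilon> \<le> F x \<and> F y + \<epsilon> \<noteq> F x" if "F y + \<epsilon> \<le> F p" for y
    using that assms(2)
    by (intro less_p_imp) (auto simp: less_p_def less_eq_vec_def intro: le_less_trans)
  with assms(1) show ?thesis
    by (auto simp: robust_def eps_pareto_set_def neg_dominates_def)
qed

text \<open>If \<open>z\<close> dominated \<open>y\<close>, adding \<epsilon> would make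
  \<open>z\<close> -\<epsilon>-dominate \<open>x\<close>. Thus a point of
  \<open>eps_pareto_set\<close> that fails to be robust falls under (A3).\<close>

lemma shifted_value_imp_pareto:
  assumes "x \<in> eps_pareto_set F Q \<epsilon>" "y \<in> Q" "F y + \<epsilon> = F x"
  shows "y \<in> pareto_set F Q"
  using assms
  by (auto simp: pareto_set_def eps_pareto_set_def dominates_def neg_dominates_def)
    (metis add_right_cancel add_right_mono)

lemma pareto_subset_eps_pareto:
  fixes \<epsilon> :: "real ^ 'k"
  assumes "\<And>i. 0 < \<epsilon> $ i"
  shows "pareto_set F Q \<subseteq> eps_pareto_set F Q \<epsilon>"
proof -
  have "F y \<le> F x \<and> F y \<noteq> F x" if "F y + \<epsilon> \<le> F x" for x y
  proof (rule less_p_imp, unfold less_p_def, rule allI)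
    fix i
    have "F y $ i + \<epsilon> $ i \<le> F x $ i" using that by (simp add: less_eq_vec_def)
    with assms[of i] show "F y $ i < F x $ i" by linarith
  qed
  then show ?thesis
    by (auto simp: pareto_set_def eps_pareto_set_def dominates_def neg_dominates_def)
qed

text \<open>Minimise the sum of the objectives over the compact part \<open>S\<close> of
  \<open>Q\<close> with values below \<open>F x\<close>. A point dominating the minimiser would
  again lie in \<open>S\<close> and have a smaller sum.\<close>

lemma pareto_below:
  fixes F :: "'a::metric_space \<Rightarrow> real ^ 'k"
  assumes "continuous_on Q F" "compact Q" "x \<in> Q"
  obtains y where "y \<in> pareto_set F Q" "F y \<le> F x"
proof -
  define S where "S = {z \<in> Q. \<forall>i. F z $ i \<le> F x $ i}"
  have "closed {z \<in> Q. F z $ i \<le> F x $ i}" for i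
    using assms by (intro continuous_on_closed_Collect_le continuous_intros compact_imp_closed)
  then have "closed (\<Inter>i. {z \<in> Q. F z $ i \<le> F x $ i})" by auto
  moreover have "S = Q \<inter> (\<Inter>i. {z \<in> Q. F z $ i \<le> F x $ i})" by (auto simp: S_def)
  ultimately have "compact S" using assms by (simp add: compact_Int_closed)
  moreover have "x \<in> S" using assms by (simp add: S_def)
  moreover have "continuous_on S (\<lambda>z. \<Sum>i\<in>UNIV. F z $ i)"
    by (intro continuous_intros continuous_on_subset[OF assms(1)]) (auto simp: S_def)
  ultimately obtain y where y: "y \<in> S" "\<And>z. z \<in> S \<Longrightarrow> (\<Sum>i\<in>UNIV. F y $ i) \<le> (\<Sum>i\<in>UNIV. F z $ i)"
    using continuous_attains_inf[of S "\<lambda>z. \<Sum>i\<in>UNIV. F z $ i"] by blast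
  have "\<not> dominates F z y" if "z \<in> Q" for z
  proof
    assume d: "dominates F z y"
    then have le: "F z $ i \<le> F y $ i" for i by (simp add: dominates_def less_eq_vec_def)
    then have "z \<in> S" using that y(1) by (auto simp: S_def intro: order.trans)
    from d obtain j where "F z $ j \<noteq> F y $ j" by (auto simp: dominates_def vec_eq_iff)
    with le[of j] have "F z $ j < F y $ j" by simp
    then have "(\<Sum>i\<in>UNIV. F z $ i) < (\<Sum>i\<in>UNIV. F y $ i)"
      using le by (intro sum_strict_mono_ex1) auto
    with y(2)[OF \<open>z \<in> S\<close>] show False by simp
  qed
  with y(1) show thesis
    by (intro that[of y]) (auto simp: S_def pareto_set_def less_eq_vec_def)
qed

lemma infnorm_less_near:
  fixes F :: "'a::metric_space \<Rightarrow> real ^ 'k"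
  assumes "continuous_on UNIV F" "0 < \<eta>"
  obtains \<delta> where "\<delta> > 0" "\<And>z. dist p z < \<delta> \<Longrightarrow> infnorm (F z - F p) < \<eta>"
proof -
  obtain \<delta> where "\<delta> > 0" "\<And>z. dist z p < \<delta> \<Longrightarrow> dist (F z) (F p) < \<eta>"
    using assms unfolding continuous_on_iff by (metis UNIV_I)
  then show thesis
    by (intro that[of \<delta>]) (auto simp: dist_commute dist_norm intro: le_less_trans[OF infnorm_le_norm])
qed

text \<open>A whole ball is produced because the sampling hypothesis speaks of balls only. Its
  centre \<open>p\<close> is \<open>x\<close> itself if \<open>x\<close> is robust, and a nearby
  descent point otherwise.\<close>

lemma eps_pareto_approx_robust:
  fixes F :: "real ^ 'n \<Rightarrow> real ^ 'k"
  assumes cont: "continuous_on UNIV F" and Q: "compact Q"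
    and grad: "\<And>i. GDERIV (\<lambda>z. F z $ i) x :> g i"
    and x: "x \<in> eps_pareto_set F Q \<epsilon>"
    and B: "\<exists>y\<in>pareto_set F Q. F y + \<epsilon> = F x \<Longrightarrow> x \<in> interior Q \<and> min_norm_comb g \<noteq> 0"
    and "0 < \<eta>"
  obtains p \<delta> where "p \<in> Q" "\<delta> > 0"
    "\<And>z. z \<in> Q \<Longrightarrow> dist p z < \<delta> \<Longrightarrow> robust F Q \<epsilon> z \<and> infnorm (F z - F x) < \<eta>"
proof -
  have xQ: "x \<in> Q" using x by (simp add: eps_pareto_set_def)
  obtain \<delta>0 where \<delta>0: "\<delta>0 > 0" "\<And>z. dist x z < \<delta>0 \<Longrightarrow> infnorm (F z - F x) < \<eta> / 2"
    using infnorm_less_near[OF cont, of "\<eta> / 2"] \<open>0 < \<eta>\<close> by (metis half_gt_zero)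
  obtain p where p: "p \<in> Q" "robust F Q \<epsilon> p" "infnorm (F p - F x) < \<eta> / 2"
  proof (cases "robust F Q \<epsilon> x")
    case True
    with xQ \<open>0 < \<eta>\<close> show thesis by (intro that[of x]) (auto simp: infnorm_0)
  next
    case False
    then obtain y where "y \<in> Q" "F y + \<epsilon> = F x"
      using x by (auto simp: robust_def eps_pareto_set_def neg_dominates_def)
    then have "x \<in> interior Q \<and> min_norm_comb g \<noteq> 0"
      using B shifted_value_imp_pareto[OF x] by blast
    \<comment> \<open>The interior keeps the descent step feasible; the ball keeps its image within
      \<open>\<eta> / 2\<close> of \<open>F x\<close>.\<close>
    with common_descent[of F x g "interior Q \<inter> ball x \<delta>0"] grad \<delta>0(1)
    obtain p where "p \<in> interior Q" "dist x p < \<delta>0" "F p <\<^sub>p F x" by (auto simp: open_Int)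
    with robust_below[OF x] \<delta>0(2) interior_subset show thesis by (intro that[of p]) auto
  qed
  obtain \<delta>1 where \<delta>1: "\<delta>1 > 0" "\<And>z. z \<in> Q \<Longrightarrow> dist p z < \<delta>1 \<Longrightarrow> robust F Q \<epsilon> z"
    using robust_open[OF continuous_on_subset[OF cont] Q p(1,2)] by blast
  obtain \<delta>2 where \<delta>2: "\<delta>2 > 0" "\<And>z. dist p z < \<delta>2 \<Longrightarrow> infnorm (F z - F p) < \<eta> / 2"
    using infnorm_less_near[OF cont, of "\<eta> / 2"] \<open>0 < \<eta>\<close> by (metis half_gt_zero)
  have "infnorm (F z - F x) < \<eta>" if "dist p z < \<delta>2" for z
    using infnorm_triangle[of "F z - F p" "F p - F x"] \<delta>2(2)[OF that] p(3) by simp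
  with \<delta>1 \<delta>2(1) p(1) show thesis by (intro that[of p "min \<delta>1 \<delta>2"]) auto
qed

section \<open>Invariants of the archive\<close>

text \<open>The separation of images gives claim (a); the absence of mutual domination is what (b2)
  rests on.\<close>

definition archive_inv ::
  "('a \<Rightarrow> real ^ 'k) \<Rightarrow> 'a set \<Rightarrow> real ^ 'k \<Rightarrow> real \<Rightarrow> real \<Rightarrow> 'a set \<Rightarrow> bool" where
  "archive_inv F Q \<epsilon> \<Delta> \<Delta>s A \<longleftrightarrow> A \<subseteq> Q \<and>
    (\<forall>a\<in>A. \<forall>b\<in>A. (a \<noteq> b \<longrightarrow> \<Delta>s \<le> infnorm (F a - F b)) \<and> \<not> neg_dominates F (\<epsilon> + vec \<Delta>) a b)"

lemma not_neg_dominates_self: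
  fixes \<epsilon> :: "real ^ 'k"
  assumes "\<And>i. 0 < \<epsilon> $ i"
  shows "\<not> neg_dominates F \<epsilon> a a"
  using assms by (auto simp: neg_dominates_def less_eq_vec_def not_le)

lemma neg_dominates_shrink:
  fixes \<epsilon> :: "real ^ 'k"
  assumes "neg_dominates F (\<epsilon> + vec \<Delta>) a b" "0 < \<Delta>"
  shows "neg_dominates F \<epsilon> a b"
proof -
  have "F a $ i + \<epsilon> $ i < F b $ i" for i
  proof -
    have "F a $ i + (\<epsilon> $ i + \<Delta>) \<le> F b $ i"
      using assms(1) by (simp add: neg_dominates_def less_eq_vec_def)
    with assms(2) show ?thesis by linarith
  qed
  then show ?thesis
    unfolding neg_dominates_def by (intro less_p_imp) (simp add: less_p_def)
qed

text \<open>If \<open>p\<close> is accepted, the members it -(\<epsilon>+\<Delta>)-dominates are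
  deleted. In the other direction, a member that -(\<epsilon>+\<Delta>)-dominates \<open>p\<close>
  would already -\<epsilon>-dominate it and have caused its rejection.\<close>

lemma archive_inv_insert:
  assumes inv: "archive_inv F Q \<epsilon> \<Delta> \<Delta>s A" and p: "p \<in> Q"
    and eps: "\<And>i. 0 < \<epsilon> $ i" and "0 < \<Delta>"
  shows "archive_inv F Q \<epsilon> \<Delta> \<Delta>s (archive_insert F \<epsilon> \<Delta> \<Delta>s p A)"
proof (cases "(\<exists>a\<in>A. neg_dominates F \<epsilon> a p) \<or> (\<exists>a\<in>A. infnorm (F a - F p) \<le> \<Delta>s)")
  case True
  with inv show ?thesis by (auto simp: archive_insert_def)
next
  case False
  then have far: "\<Delta>s \<le> infnorm (F a - F p)" "\<Delta>s \<le> infnorm (F p - F a)"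
    and nd: "\<not> neg_dominates F (\<epsilon> + vec \<Delta>) a p" if "a \<in> A" for a
    using that neg_dominates_shrink[OF _ \<open>0 < \<Delta>\<close>, of F \<epsilon> a p]
    by (auto simp: infnorm_sub[of "F p"] not_le less_imp_le)
  have "\<And>i. 0 < (\<epsilon> + vec \<Delta>) $ i" using eps \<open>0 < \<Delta>\<close> by (simp add: add_pos_pos)
  from not_neg_dominates_self[OF this] False inv p far nd show ?thesis
    unfolding archive_inv_def archive_insert_def by auto
qed

lemma archive_inv_fold:
  assumes "archive_inv F Q \<epsilon> \<Delta> \<Delta>s A" "set ps \<subseteq> Q" "\<And>i. 0 < \<epsilon> $ i" "0 < \<Delta>"
  shows "archive_inv F Q \<epsilon> \<Delta> \<Delta>s (fold (archive_insert F \<epsilon> \<Delta> \<Delta>s) ps A)"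
  using assms by (induction ps arbitrary: A) (auto intro: archive_inv_insert)

section \<open>Persistence of archive members near a robust candidate\<close>

text \<open>The witness \<open>a\<close> itself survives. If \<open>z\<close> deleted it, then F(z)
  + \<epsilon> + \<Delta> \<le> F(a) \<le> F(p) + \<open>\<Delta>s\<close> componentwise, and
  \<open>\<Delta>s < \<Delta>\<close> would give F(z) + \<epsilon> \<le> F(p), against robustness of
  \<open>p\<close>.\<close>

lemma near_robust_insert:
  fixes F :: "'a \<Rightarrow> real ^ 'k"
  assumes near: "\<exists>a\<in>A. infnorm (F a - F p) \<le> \<Delta>s" and "robust F Q \<epsilon> p" "z \<in> Q" "\<Delta>s < \<Delta>"
  shows "\<exists>a\<in>archive_insert F \<epsilon> \<Delta> \<Delta>s z A. infnorm (F a - F p) \<le> \<Delta>s"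
proof -
  obtain a where a: "a \<in> A" "infnorm (F a - F p) \<le> \<Delta>s" using near by blast
  have "\<not> neg_dominates F (\<epsilon> + vec \<Delta>) z a"
  proof
    assume d: "neg_dominates F (\<epsilon> + vec \<Delta>) z a"
    have "F z $ i + \<epsilon> $ i \<le> F p $ i" for i
    proof -
      have "F z $ i + (\<epsilon> $ i + \<Delta>) \<le> F a $ i"
        using d by (simp add: neg_dominates_def less_eq_vec_def)
      moreover have "\<bar>F a $ i - F p $ i\<bar> \<le> \<Delta>s"
        using component_le_infnorm_cart[of "F a - F p" i] a(2) by simp
      ultimately show ?thesis using \<open>\<Delta>s < \<Delta>\<close> by linarith
    qed
    with assms(2,3) show False by (auto simp: robust_def less_eq_vec_def)
  qed
  with a show ?thesis by (auto simp: archive_insert_def)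
qed

lemma near_robust_fold:
  fixes F :: "'a \<Rightarrow> real ^ 'k"
  assumes "\<exists>a\<in>A. infnorm (F a - F p) \<le> \<Delta>s" "robust F Q \<epsilon> p" "set ps \<subseteq> Q" "\<Delta>s < \<Delta>"
  shows "\<exists>a\<in>fold (archive_insert F \<epsilon> \<Delta> \<Delta>s) ps A. infnorm (F a - F p) \<le> \<Delta>s"
  using assms(1,3)
proof (induction ps arbitrary: A)
  case (Cons z ps)
  then show ?case
    using near_robust_insert[OF Cons.prems(1) assms(2) _ assms(4), of z] by simp
qed simp

text \<open>A robust \<open>p\<close> can only be rejected because some member is already within
  \<open>\<Delta>s\<close>, and that member stays. If accepted, \<open>p\<close> is its own witness,
  as it does not delete itself.\<close>

lemma near_robust_insert_self:
  assumes "A \<subseteq> Q" "robust F Q \<epsilon> p" "0 \<le> \<Delta>s" "\<And>i. 0 < \<epsilon> $ i" "0 < \<Delta>"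
  shows "\<exists>a\<in>archive_insert F \<epsilon> \<Delta> \<Delta>s p A. infnorm (F a - F p) \<le> \<Delta>s"
proof -
  have "\<not> neg_dominates F \<epsilon> a p" if "a \<in> A" for a
    using that assms(1,2) by (auto simp: robust_def neg_dominates_def)
  moreover have "\<not> neg_dominates F (\<epsilon> + vec \<Delta>) p p"
    using assms(4,5) by (intro not_neg_dominates_self) (simp add: add_pos_pos)
  ultimately show ?thesis using assms(3) by (auto simp: archive_insert_def infnorm_0)
qed

text \<open>Split the processing order at \<open>p\<close>: inserting \<open>p\<close> creates a
  witness, whatever came before, and the later insertions preserve it.\<close>

lemma near_robust_fold_mem:
  assumes inv: "archive_inv F Q \<epsilon> \<Delta> \<Delta>s A" and "robust F Q \<epsilon> p" "p \<in> set ps" "set ps \<subseteq> Q"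
    and "\<And>i. 0 < \<epsilon> $ i" "0 \<le> \<Delta>s" "\<Delta>s < \<Delta>"
  shows "\<exists>a\<in>fold (archive_insert F \<epsilon> \<Delta> \<Delta>s) ps A. infnorm (F a - F p) \<le> \<Delta>s"
proof -
  obtain xs ys where ps: "ps = xs @ p # ys" using assms(3) by (meson split_list)
  define A' where "A' = fold (archive_insert F \<epsilon> \<Delta> \<Delta>s) xs A"
  have "archive_inv F Q \<epsilon> \<Delta> \<Delta>s A'"
    unfolding A'_def using assms by (intro archive_inv_fold) (auto simp: ps)
  then have "A' \<subseteq> Q" by (simp add: archive_inv_def)
  then have "\<exists>a\<in>archive_insert F \<epsilon> \<Delta> \<Delta>s p A'. infnorm (F a - F p) \<le> \<Delta>s"
    using assms by (intro near_robust_insert_self) auto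
  from near_robust_fold[OF this assms(2) _ assms(7), of ys] show ?thesis
    using assms(4) by (simp add: ps A'_def)
qed

section \<open>From the inner bound (b1) to the outer bound (b2); distances and nets\<close>

text \<open>If \<open>y\<close> -(\<epsilon>+2\<Delta>)-dominates a member \<open>x\<close>, (b1)
  supplies a member \<open>a\<close> whose image is less than \<Delta> away from that of a Pareto
  point below \<open>y\<close>. This costs one of the two \<Delta>, so \<open>a\<close> still
  -(\<epsilon>+\<Delta>)-dominates \<open>x\<close>, which the invariant forbids.\<close>

lemma archive_subset_eps_pareto:
  fixes F :: "'a::metric_space \<Rightarrow> real ^ 'k"
  assumes "continuous_on Q F" "compact Q" and eps: "\<And>i. 0 < \<epsilon> $ i"
    and inv: "archive_inv F Q \<epsilon> \<Delta> \<Delta>s A"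
    and b1: "dist_set (F ` eps_pareto_set F Q \<epsilon>) (F ` A) < ennreal \<Delta>"
  shows "A \<subseteq> eps_pareto_set F Q (\<epsilon> + 2 *\<^sub>R vec \<Delta>)"
proof
  fix x assume x: "x \<in> A"
  have False if "y \<in> Q" and d: "neg_dominates F (\<epsilon> + 2 *\<^sub>R vec \<Delta>) y x" for y
  proof -
    obtain y' where y': "y' \<in> pareto_set F Q" "F y' \<le> F y"
      using pareto_below[OF assms(1,2) \<open>y \<in> Q\<close>] by blast
    with pareto_subset_eps_pareto[of \<epsilon> F Q] eps have "y' \<in> eps_pareto_set F Q \<epsilon>" by blast
    then have "dist_point (F y') (F ` A) < ennreal \<Delta>"
      using b1 unfolding dist_set_def by (meson SUP_upper image_eqI le_less_trans)
    \<comment> \<open>An infimum strictly below \<Delta> is undercut by an actual member; an empty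
      archive would have infimum \<infinity>.\<close>
    then obtain a where a: "a \<in> A" "ennreal (infnorm (F y' - F a)) < ennreal \<Delta>"
      unfolding dist_point_def by (auto simp: INF_less_iff)
    then have lt: "infnorm (F y' - F a) < \<Delta>"
      by (metis ennreal_leI not_le)
    have "F a $ i + (\<epsilon> $ i + \<Delta>) < F x $ i" for i
    proof -
      have "\<bar>F y' $ i - F a $ i\<bar> < \<Delta>"
        using component_le_infnorm_cart[of "F y' - F a" i] lt by simp
      moreover have "F y' $ i \<le> F y $ i" using y' by (simp add: less_eq_vec_def)
      moreover have "F y $ i + (\<epsilon> $ i + 2 * \<Delta>) \<le> F x $ i"
        using d by (simp add: neg_dominates_def less_eq_vec_def)
      ultimately show ?thesis by linarith
    qed
    then have "neg_dominates F (\<epsilon> + vec \<Delta>) a x"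
      unfolding neg_dominates_def by (intro less_p_imp) (simp add: less_p_def)
    with inv a(1) x show False by (simp add: archive_inv_def)
  qed
  with x inv show "x \<in> eps_pareto_set F Q (\<epsilon> + 2 *\<^sub>R vec \<Delta>)"
    by (auto simp: archive_inv_def eps_pareto_set_def)
qed

lemma dist_set_mono: "A \<subseteq> B \<Longrightarrow> dist_set A C \<le> dist_set B C"
  unfolding dist_set_def by (rule SUP_subset_mono) auto

lemma dist_set_leI:
  assumes "\<And>u. u \<in> B \<Longrightarrow> \<exists>v\<in>A. infnorm (u - v) \<le> r"
  shows "dist_set B A \<le> ennreal r"
  unfolding dist_set_def dist_point_def
  using assms by (intro SUP_least) (meson INF_lower2 ennreal_leI)

text \<open>\<open>S\<close> is not assumed closed, so its compact closure is covered, but by balls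
  with centres in \<open>S\<close>. In the application the centres must be images of points of
  \<open>eps_pareto_set\<close>.\<close>

lemma finite_net_within:
  fixes S :: "'a::heine_borel set"
  assumes "bounded S" "0 < \<eta>"
  obtains N where "finite N" "N \<subseteq> S" "\<And>u. u \<in> S \<Longrightarrow> \<exists>v\<in>N. dist v u < \<eta>"
proof -
  have "closure S \<subseteq> (\<Union>v\<in>S. ball v \<eta>)"
    using \<open>0 < \<eta>\<close> by (auto simp: closure_approachable)
  moreover have "compact (closure S)" using assms(1) by (simp add: compact_closure)
  ultimately obtain N where "N \<subseteq> S" "finite N" "closure S \<subseteq> (\<Union>v\<in>N. ball v \<eta>)"
    by (metis compactE_image open_ball)
  then show thesis
    using closure_subset[of S] by (intro that[of N]) (auto simp: subset_iff)
qed

section \<open>Almost sure convergence of the archives\<close>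

theorem theorem3p2:
  fixes F :: "real ^ 'n \<Rightarrow> real ^ 'k"
    and gradF :: "'k \<Rightarrow> real ^ 'n \<Rightarrow> real ^ 'n"
    and Q :: "(real ^ 'n) set"
    and \<epsilon> :: "real ^ 'k"
    and \<Delta> \<Delta>s :: real
    and M :: "'w measure"
    and Gen :: "nat \<Rightarrow> 'w \<Rightarrow> (real ^ 'n) set \<Rightarrow> (real ^ 'n) set"
    and P A :: "nat \<Rightarrow> 'w \<Rightarrow> (real ^ 'n) set"
    and \<B> :: "(real ^ 'n) set"
  defines "\<B> \<equiv> {x \<in> Q. \<exists>y\<in>pareto_set F Q. F y + \<epsilon> = F x}"
  assumes cont: "continuous_on UNIV F"
    and grad: "\<And>i x. GDERIV (\<lambda>z. F z $ i) x :> gradF i x"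
    and grad_cont: "\<And>i. continuous_on UNIV (gradF i)"
    and Q: "compact Q"
    and eps: "\<And>i. 0 < \<epsilon> $ i"
    and Delta: "0 < \<Delta>s" "\<Delta>s < \<Delta>"
    and M: "prob_space M"
    and search: "generic_search M Q Gen (archive_update F \<epsilon> \<Delta> \<Delta>s) P A"
    and sampling: "\<And>x \<delta>. x \<in> Q \<Longrightarrow> \<delta> > 0 \<Longrightarrow>
      measure M {\<omega> \<in> space M. \<exists>l. P l \<omega> \<inter> ball x \<delta> \<inter> Q \<noteq> {}} = 1"
    and A1: "\<not> (\<exists>x \<in> Q - pareto_set F Q. weak_pareto F Q x)"
    and A2: "\<not> (\<exists>x \<in> Q - closure (eps_pareto_set F Q \<epsilon>). neg_eps_weak_pareto F Q \<epsilon> x)"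
    and A3: "\<B> \<subseteq> interior Q" "\<And>x. x \<in> \<B> \<Longrightarrow> min_norm_comb (\<lambda>i. gradF i x) \<noteq> 0"
  shows "(\<forall>\<omega>\<in>space M. \<forall>l. \<forall>a\<^sub>1\<in>A l \<omega>. \<forall>a\<^sub>2\<in>A l \<omega>.
            a\<^sub>1 \<noteq> a\<^sub>2 \<longrightarrow> infnorm (F a\<^sub>1 - F a\<^sub>2) \<ge> \<Delta>s) \<and>
         (AE \<omega> in M. \<exists>l\<^sub>0. \<forall>l\<ge>l\<^sub>0.
            dist_set (F ` eps_pareto_set F Q \<epsilon>) (F ` A l \<omega>) < ennreal \<Delta> \<and>
            dist_set (F ` A l \<omega>) (F ` eps_pareto_set F Q \<epsilon>)
              \<le> dist_set (F ` eps_pareto_set F Q (\<epsilon> + 2 *\<^sub>R vec \<Delta>)) (F ` eps_pareto_set F Q \<epsilon>) \<and>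
            dist_H (F ` eps_pareto_set F Q \<epsilon>) (F ` A l \<omega>)
              \<le> max (ennreal \<Delta>)
                    (dist_set (F ` eps_pareto_set F Q (\<epsilon> + 2 *\<^sub>R vec \<Delta>)) (F ` eps_pareto_set F Q \<epsilon>)))"
proof -
  let ?PE = "eps_pareto_set F Q \<epsilon>"
  let ?near = "\<lambda>r x l \<omega>. \<exists>a\<in>A l \<omega>. infnorm (F x - F a) \<le> r"
  have contQ: "continuous_on Q F" using cont continuous_on_subset by blast
  have PQ: "P l \<omega> \<subseteq> Q" if "\<omega> \<in> space M" for l \<omega>
    using search that by (auto simp: generic_search_def)
  have A0: "\<exists>ps. set ps = P 0 \<omega> \<and> A 0 \<omega> = fold (archive_insert F \<epsilon> \<Delta> \<Delta>s) ps {}"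
    if "\<omega> \<in> space M" for \<omega>
    using search that by (force simp: generic_search_def archive_update_def)
  have A_Suc: "\<exists>ps. set ps = P (Suc l) \<omega> \<and> A (Suc l) \<omega> = fold (archive_insert F \<epsilon> \<Delta> \<Delta>s) ps (A l \<omega>)"
    if "\<omega> \<in> space M" for l \<omega>
    using search that unfolding generic_search_def archive_update_def by blast
  have "archive_inv F Q \<epsilon> \<Delta> \<Delta>s {}" by (simp add: archive_inv_def)
  then have inv: "archive_inv F Q \<epsilon> \<Delta> \<Delta>s (A l \<omega>)" if "\<omega> \<in> space M" for l \<omega>
  proof (induction l)
    case 0
    then show ?case using A0[OF that] PQ[OF that] eps Delta archive_inv_fold by (metis order.strict_trans)
  next
    case (Suc l)
    then show ?case using A_Suc[OF that] PQ[OF that] eps Delta archive_inv_fold by (metis order.strict_trans)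
  qed
  \<comment> \<open>The case \<open>l = 0\<close> is separate because the first update starts from
    the empty archive.\<close>
  have mem: "\<exists>a\<in>A l \<omega>. infnorm (F a - F p) \<le> \<Delta>s"
    if "\<omega> \<in> space M" "p \<in> P l \<omega>" "robust F Q \<epsilon> p" for l \<omega> p
  proof (cases l)
    case 0
    obtain ps where "set ps = P 0 \<omega>" "A 0 \<omega> = fold (archive_insert F \<epsilon> \<Delta> \<Delta>s) ps {}"
      using A0[OF \<open>\<omega> \<in> space M\<close>] by blast
    with near_robust_fold_mem[OF \<open>archive_inv F Q \<epsilon> \<Delta> \<Delta>s {}\<close>, of p ps] 0 that PQ eps Delta
    show ?thesis by auto
  next
    case (Suc m)
    obtain ps where "set ps = P l \<omega>" "A l \<omega> = fold (archive_insert F \<epsilon> \<Delta> \<Delta>s) ps (A m \<omega>)"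
      using A_Suc[OF \<open>\<omega> \<in> space M\<close>] Suc by blast
    with near_robust_fold_mem[OF inv[of \<omega> m], of p ps] that PQ eps Delta
    show ?thesis by auto
  qed
  have stays: "\<exists>a\<in>A l' \<omega>. infnorm (F a - F p) \<le> \<Delta>s"
    if "\<omega> \<in> space M" "p \<in> P l \<omega>" "robust F Q \<epsilon> p" "l \<le> l'" for l l' \<omega> p
    using \<open>l \<le> l'\<close>
  proof (induction l' rule: dec_induct)
    case base
    show ?case using mem that by blast
  next
    case (step m)
    then show ?case
      using A_Suc[OF \<open>\<omega> \<in> space M\<close>, of m] PQ[OF \<open>\<omega> \<in> space M\<close>] near_robust_fold that(3) Delta(2)
      by metis
  qed
  \<comment> \<open>Error budget: \<open>\<Delta>s\<close> from an archive member to a sampled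
    point, one \<open>\<eta>\<close> from there to a net point, one \<open>\<eta>\<close> from the
    net point to an arbitrary point of the image. The remaining third keeps the bound strict after
    the supremum.\<close>
  define \<eta> where "\<eta> = (\<Delta> - \<Delta>s) / 3"
  have \<eta>: "0 < \<eta>" and r: "\<Delta>s + \<eta> + \<eta> < \<Delta>" using Delta by (auto simp: \<eta>_def field_simps)
  \<comment> \<open>The exceptional null set may depend on \<open>x\<close>; therefore this is used
    for finitely many \<open>x\<close> only.\<close>
  have near: "AE \<omega> in M. \<forall>\<^sub>F l in sequentially. ?near (\<Delta>s + \<eta>) x l \<omega>" if "x \<in> ?PE" for x
  proof -
    have "x \<in> Q" using that by (simp add: eps_pareto_set_def)
    then have "x \<in> interior Q \<and> min_norm_comb (\<lambda>i. gradF i x) \<noteq> 0"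
      if "\<exists>y\<in>pareto_set F Q. F y + \<epsilon> = F x"
      using that A3 by (auto simp: \<B>_def)
    from eps_pareto_approx_robust[OF cont Q grad that this \<eta>]
    obtain p \<delta> where p: "p \<in> Q" "\<delta> > 0"
      "\<And>z. z \<in> Q \<Longrightarrow> dist p z < \<delta> \<Longrightarrow> robust F Q \<epsilon> z \<and> infnorm (F z - F x) < \<eta>" by blast
    \<comment> \<open>\<open>measure\<close> is 0 on sets that are not measurable, so the value 1
      also yields measurability of this event.\<close>
    have "AE \<omega> in M. \<omega> \<in> {\<omega> \<in> space M. \<exists>l. P l \<omega> \<inter> ball p \<delta> \<inter> Q \<noteq> {}}"
      using sampling[OF p(1,2)] M prob_space.AE_prob_1 by blast
    then show ?thesis
    proof (rule AE_mp, intro AE_I2 impI)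
      fix \<omega> assume \<omega>: "\<omega> \<in> space M" "\<omega> \<in> {\<omega> \<in> space M. \<exists>l. P l \<omega> \<inter> ball p \<delta> \<inter> Q \<noteq> {}}"
      then obtain l z where z: "z \<in> P l \<omega>" "z \<in> Q" "dist p z < \<delta>" by auto
      have "?near (\<Delta>s + \<eta>) x l' \<omega>" if l': "l \<le> l'" for l'
      proof -
        obtain a where "a \<in> A l' \<omega>" "infnorm (F a - F z) \<le> \<Delta>s"
          using stays[OF \<omega>(1) z(1) _ l'] p(3) z by blast
        moreover have "infnorm (F x - F a) \<le> infnorm (F z - F x) + infnorm (F a - F z)"
          using infnorm_triangle[of "F x - F z" "F z - F a"]
          by (simp add: infnorm_sub[of "F x" "F z"] infnorm_sub[of "F z" "F a"])
        ultimately show ?thesis using p(3)[of z] z by force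
      qed
      then show "\<forall>\<^sub>F l in sequentially. ?near (\<Delta>s + \<eta>) x l \<omega>"
        by (auto simp: eventually_sequentially)
    qed
  qed
  have "bounded (F ` ?PE)"
    using compact_imp_bounded[OF compact_continuous_image[OF contQ Q]]
    by (rule bounded_subset) (auto simp: eps_pareto_set_def)
  from finite_net_within[OF this \<eta>] obtain N where
    "finite N" "N \<subseteq> F ` ?PE" and net: "\<And>u. u \<in> F ` ?PE \<Longrightarrow> \<exists>v\<in>N. dist v u < \<eta>" by blast
  then obtain X where X: "finite X" "X \<subseteq> ?PE" "N = F ` X" by (metis finite_subset_image)
  \<comment> \<open>Finiteness of \<open>X\<close> is used twice: here to unite the null sets, and
    below to find one \<open>l\<close> from which on all net points are approximated.\<close>
  have "AE \<omega> in M. \<forall>x\<in>X. \<forall>\<^sub>F l in sequentially. ?near (\<Delta>s + \<eta>) x l \<omega>"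
    using X near by (intro AE_finite_allI) auto
  then have "AE \<omega> in M. \<exists>l\<^sub>0. \<forall>l\<ge>l\<^sub>0. dist_set (F ` ?PE) (F ` A l \<omega>) < ennreal \<Delta>"
  proof (rule AE_mp, intro AE_I2 impI)
    fix \<omega> assume "\<forall>x\<in>X. \<forall>\<^sub>F l in sequentially. ?near (\<Delta>s + \<eta>) x l \<omega>"
    then have "\<forall>\<^sub>F l in sequentially. \<forall>x\<in>X. ?near (\<Delta>s + \<eta>) x l \<omega>"
      using X(1) by (simp add: eventually_ball_finite)
    then have "\<forall>\<^sub>F l in sequentially. dist_set (F ` ?PE) (F ` A l \<omega>) < ennreal \<Delta>"
    proof eventually_elim
      case (elim l)
      have "dist_set (F ` ?PE) (F ` A l \<omega>) \<le> ennreal (\<Delta>s + \<eta> + \<eta>)"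
      proof (rule dist_set_leI)
        fix u assume "u \<in> F ` ?PE"
        then obtain x where x: "x \<in> X" "dist (F x) u < \<eta>" using net X(3) by blast
        then obtain a where a: "a \<in> A l \<omega>" "infnorm (F x - F a) \<le> \<Delta>s + \<eta>" using elim by blast
        have "infnorm (u - F x) < \<eta>"
          using x(2) infnorm_le_norm[of "u - F x"] by (simp add: dist_norm norm_minus_commute)
        then have "infnorm (u - F a) \<le> \<Delta>s + \<eta> + \<eta>"
          using infnorm_triangle[of "u - F x" "F x - F a"] a(2) by simp
        with a(1) show "\<exists>v\<in>F ` A l \<omega>. infnorm (u - v) \<le> \<Delta>s + \<eta> + \<eta>" by blast
      qed
      also have "\<dots> < ennreal \<Delta>" using r Delta by (intro ennreal_lessI) auto
      finally show ?case .
    qed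
    then show "\<exists>l\<^sub>0. \<forall>l\<ge>l\<^sub>0. dist_set (F ` ?PE) (F ` A l \<omega>) < ennreal \<Delta>"
      by (simp add: eventually_sequentially)
  qed
  then have "AE \<omega> in M. \<exists>l\<^sub>0. \<forall>l\<ge>l\<^sub>0.
      dist_set (F ` ?PE) (F ` A l \<omega>) < ennreal \<Delta> \<and>
      dist_set (F ` A l \<omega>) (F ` ?PE)
        \<le> dist_set (F ` eps_pareto_set F Q (\<epsilon> + 2 *\<^sub>R vec \<Delta>)) (F ` ?PE) \<and>
      dist_H (F ` ?PE) (F ` A l \<omega>)
        \<le> max (ennreal \<Delta>) (dist_set (F ` eps_pareto_set F Q (\<epsilon> + 2 *\<^sub>R vec \<Delta>)) (F ` ?PE))"
  proof (rule AE_mp, intro AE_I2 impI)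
    fix \<omega> assume \<omega>: "\<omega> \<in> space M"
      and "\<exists>l\<^sub>0. \<forall>l\<ge>l\<^sub>0. dist_set (F ` ?PE) (F ` A l \<omega>) < ennreal \<Delta>"
    then obtain l\<^sub>0 where l\<^sub>0: "\<And>l. l \<ge> l\<^sub>0 \<Longrightarrow> dist_set (F ` ?PE) (F ` A l \<omega>) < ennreal \<Delta>" by blast
    \<comment> \<open>For a fixed outcome the rest is deterministic: at each \<open>l\<close>, (b1)
      confines the archive to the larger set, which gives (b2) by monotonicity, and (b3) is the
      maximum of the two bounds.\<close>
    have b2: "dist_set (F ` A l \<omega>) (F ` ?PE)
        \<le> dist_set (F ` eps_pareto_set F Q (\<epsilon> + 2 *\<^sub>R vec \<Delta>)) (F ` ?PE)" if "l \<ge> l\<^sub>0" for l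
      using archive_subset_eps_pareto[OF contQ Q eps inv[OF \<omega>] l\<^sub>0[OF that]]
      by (intro dist_set_mono image_mono)
    show "\<exists>l\<^sub>0. \<forall>l\<ge>l\<^sub>0.
      dist_set (F ` ?PE) (F ` A l \<omega>) < ennreal \<Delta> \<and>
      dist_set (F ` A l \<omega>) (F ` ?PE)
        \<le> dist_set (F ` eps_pareto_set F Q (\<epsilon> + 2 *\<^sub>R vec \<Delta>)) (F ` ?PE) \<and>
      dist_H (F ` ?PE) (F ` A l \<omega>)
        \<le> max (ennreal \<Delta>) (dist_set (F ` eps_pareto_set F Q (\<epsilon> + 2 *\<^sub>R vec \<Delta>)) (F ` ?PE))"
      unfolding dist_H_def
      by (intro exI[of _ l\<^sub>0] allI impI conjI max.mono l\<^sub>0 b2 less_imp_le[OF l\<^sub>0])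
  qed
  moreover have "\<forall>\<omega>\<in>space M. \<forall>l. \<forall>a\<^sub>1\<in>A l \<omega>. \<forall>a\<^sub>2\<in>A l \<omega>.
      a\<^sub>1 \<noteq> a\<^sub>2 \<longrightarrow> infnorm (F a\<^sub>1 - F a\<^sub>2) \<ge> \<Delta>s"
    using inv unfolding archive_inv_def by blast
  ultimately show ?thesis by blast
qed

end
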